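(* For $\varrho>0$ let $X_\varrho$ be the set of nonnegative sequences $\mathbf c=\{c_i\}_{i\in\mathbb N}$ with $\sum_{i=1}^\infty i c_i=\varrho$. There exist positive coagulation coefficients $\{a_i\}_{i\in\mathbb N}$ and detailed balance coefficients $\{Q_i\}_{i\in\mathbb N}$ satisfying (H1) $0<z_s<+\infty$; (H2) $Q_i=z_s^{1-i}\alpha_i$ for all $i$, where $\{\alpha_i\}$ is a non-increasing positive sequence with $\lim_{i\to\infty}\alpha_{i+1}/\alpha_i=1$; (H3) there are $C_1,C_2>0$ with $C_1i^\gamma\le a_i\le C_2i^\gamma$ for all $i$, with exponent $\gamma<1$; such that $$\inf_{\mathbf c\in X_\varrho}\frac{D(\mathbf c)}{H(\mathbf c|\mathcal Q)}=0\qquad\text{for every }0<\varrho<\varrho_s .$$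
   Context: $\mathbb N=\{1,2,3,\dots\}$. Given positive coefficients $a_i$ (coagulation) and $b_i$ (fragmentation), the detailed balance coefficients are $Q_1=1$, $Q_{i+1}=\frac{a_i}{b_{i+1}}Q_i$ (so $\{b_i\}_{i\ge2}$ and $\{Q_i\}$ determine each other given $\{a_i\}$). The critical monomer density $z_s$ is the largest $z_s\in[0,+\infty]$ such that $\sum_{i\ge1} iQ_iz^i<+\infty$ for all $0\le z<z_s$; the critical mass is $\varrho_s=\sum_{i\ge1} iQ_iz_s^i\in[0,+\infty]$ (possibly $+\infty$). In (H3) the exponent satisfies $0<\gamma\le1$ in general. For $0<\varrho<\varrho_s$, $\overline z$ is the unique nonnegative number with $\sum_{i\ge1} iQ_i\overline z^i=\varrho$, and $\mathcal Q_i=Q_i\overline z^i$. The relative free energy is $$H(\mathbf c|\mathcal Q)=\sum_{i\ge1}\mathcal Q_i\,\varphi\!\left(\frac{c_i}{\mathcal Q_i}\right),\qquad \varphi(r)=r\log r-r+1\ (\varphi(0)=1),$$ and the free energy dissipation is $$D(\mathbf c)=\sum_{i=1}^\infty a_iQ_i\left(\frac{c_1c_i}{Q_i}-\frac{c_{i+1}}{Q_{i+1}}\right)\left(\log\frac{c_1c_i}{Q_i}-\log\frac{c_{i+1}}{Q_{i+1}}\right)\in[0,+\infty],$$ where a summand $(x-y)(\log x-\log y)$ is read as $0$ if $x=y=0$ and $+\infty$ if exactly one of $x,y$ is $0$. The infimum is over $\mathbf c\in X_\varrho$ with $\mathbf c\ne\mathcal Q$ (equivalently $H(\mathbf c|\mathcal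 Q)>0$), so that the quotient is defined. *)

theory Defs
  imports "HOL-Analysis.Analysis"
begin

(* Sequences indexed by {1,2,3,...} are functions on nat whose value at 0 is
   irrelevant: either the summand carries the factor i, or the sum is written
   over Suc i. *)

definition detailed_balance ::
    "(nat \<Rightarrow> real) \<Rightarrow> (nat \<Rightarrow> real) \<Rightarrow> (nat \<Rightarrow> real) \<Rightarrow> bool" where
  "detailed_balance a b Q \<longleftrightarrow>
     Q 1 = 1 \<and> (\<forall>i\<ge>1. Q (i + 1) = a i / b (i + 1) * Q i)"

definition critical_density :: "(nat \<Rightarrow> real) \<Rightarrow> ennreal" where
  "critical_density Q =
     (GREATEST zs. \<forall>z\<ge>0. ennreal z < zs \<longrightarrow> summable (\<lambda>i. real i * Q i * z ^ i))"

definition critical_mass :: "(nat \<Rightarrow> real) \<Rightarrow> ennreal" where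
  "critical_mass Q = (\<Sum>i. of_nat i * ennreal (Q i) * critical_density Q ^ i)"

definition mass_space :: "real \<Rightarrow> (nat \<Rightarrow> real) set" where
  "mass_space \<rho> = {c. (\<forall>i\<ge>1. 0 \<le> c i) \<and> (\<lambda>i. real i * c i) sums \<rho>}"

definition equilibrium_density :: "(nat \<Rightarrow> real) \<Rightarrow> real \<Rightarrow> real" where
  "equilibrium_density Q \<rho> =
     (THE z. 0 \<le> z \<and> (\<lambda>i. real i * Q i * z ^ i) sums \<rho>)"

definition equilibrium :: "(nat \<Rightarrow> real) \<Rightarrow> real \<Rightarrow> nat \<Rightarrow> real" where
  "equilibrium Q \<rho> i = Q i * equilibrium_density Q \<rho> ^ i"

definition entropy_fun :: "real \<Rightarrow> real" where
  "entropy_fun r = r * ln r - r + 1"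

definition relative_energy :: "(nat \<Rightarrow> real) \<Rightarrow> (nat \<Rightarrow> real) \<Rightarrow> ennreal" where
  "relative_energy c E =
     (\<Sum>i. ennreal (E (Suc i) * entropy_fun (c (Suc i) / E (Suc i))))"

definition log_gap :: "real \<Rightarrow> real \<Rightarrow> ennreal" where
  "log_gap x y =
     (if x = 0 \<and> y = 0 then 0
      else if x = 0 \<or> y = 0 then \<infinity>
      else ennreal ((x - y) * (ln x - ln y)))"

definition dissipation ::
    "(nat \<Rightarrow> real) \<Rightarrow> (nat \<Rightarrow> real) \<Rightarrow> (nat \<Rightarrow> real) \<Rightarrow> ennreal" where
  "dissipation a Q c =
     (\<Sum>j. let i = Suc j in
        ennreal (a i * Q i) * log_gap (c 1 * c i / Q i) (c (i + 1) / Q (i + 1)))"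

(* In ennreal, x / \<infinity> = 0, so a quotient by the relative energy is only
   meaningful where that energy is finite. This is always so on mass_space
   when ln (E i) is bounded below by a linear function of i, as is the case for
   E = equilibrium Q \<rho> with Q i = zs powi (1 - int i) * \<alpha> i and
   \<alpha> (i + 1) / \<alpha> i tending to 1. *)
lemma relative_energy_finite:
  fixes c E :: "nat \<Rightarrow> real" and \<rho> K :: real
  assumes c: "c \<in> mass_space \<rho>" and E: "E \<in> mass_space \<rho>"
    and pos: "\<And>i. i \<ge> 1 \<Longrightarrow> 0 < E i"
    and bound: "\<And>i. i \<ge> 1 \<Longrightarrow> - K * real i \<le> ln (E i)"
  shows "relative_energy c E < \<infinity>"
proof -
  have c0: "0 \<le> c i" if "i \<ge> 1" for i using c that by (simp add: mass_space_def)
  have sc: "(\<lambda>i. real i * c i) sums \<rho>" using c by (simp add: mass_space_def)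
  have sE: "(\<lambda>i. real i * E i) sums \<rho>" using E by (simp add: mass_space_def)
  have nn: "0 \<le> real i * c i" for i using c0[of i] by (cases i) auto
  have le: "real i * c i \<le> \<rho>" for i
    using sum_le_suminf[OF sums_summable[OF sc], of "{i}"] nn sums_unique[OF sc] by auto
  have rho: "0 \<le> \<rho>" using le[of 0] by simp
  define g where "g i = (K + \<rho>) * (real i * c i) + real i * E i" for i
  have sg: "summable (\<lambda>i. g (Suc i))"
    unfolding g_def
    by (subst summable_Suc_iff)
       (intro summable_add summable_mult sums_summable[OF sc] sums_summable[OF sE])
  have bnd: "E i * entropy_fun (c i / E i) \<le> g i" if i: "i \<ge> 1" for i
  proof (cases "c i = 0")
    case True
    then show ?thesis using i pos[OF i] by (simp add: entropy_fun_def g_def)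
  next
    case False
    then have cp: "0 < c i" using c0[OF i] by simp
    have Ep: "0 < E i" by (rule pos[OF i])
    have i1: "1 \<le> real i" using i by simp
    have cle: "c i \<le> \<rho>"
      using le[of i] mult_right_mono[OF i1, of "c i"] cp by linarith
    have "ln (c i) \<le> \<rho>" using ln_le_minus_one[OF cp] cle by linarith
    also have "\<dots> \<le> \<rho> * real i" using mult_left_mono[OF i1 rho] by simp
    finally have l: "ln (c i) - ln (E i) \<le> (K + \<rho>) * real i"
      using bound[OF i] by (simp add: algebra_simps)
    have "E i * entropy_fun (c i / E i) = c i * (ln (c i) - ln (E i)) - c i + E i"
      using cp Ep by (simp add: entropy_fun_def ln_div field_simps)
    also have "\<dots> \<le> c i * ((K + \<rho>) * real i) + real i * E i"
      using mult_left_mono[OF l, of "c i"] mult_right_mono[OF i1, of "E i"] cp Ep by linarith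
    finally show ?thesis by (simp add: g_def mult_ac)
  qed
  have phi: "0 \<le> entropy_fun r" if "0 \<le> r" for r
  proof (cases "r = 0")
    case False
    then have r: "0 < r" using that by simp
    have "r * ln (1 / r) \<le> r * (1 / r - 1)"
      by (intro mult_left_mono ln_le_minus_one) (use r in auto)
    then show ?thesis using r by (simp add: entropy_fun_def ln_div right_diff_distrib)
  qed (simp add: entropy_fun_def)
  have g0: "0 \<le> g (Suc i)" for i
    using bnd[of "Suc i"] phi[of "c (Suc i) / E (Suc i)"] c0[of "Suc i"] pos[of "Suc i"]
    by (smt (verit) divide_nonneg_pos le_add1 mult_nonneg_nonneg plus_1_eq_Suc)
  have "relative_energy c E \<le> (\<Sum>i. ennreal (g (Suc i)))"
    unfolding relative_energy_def
    by (intro suminf_le ennreal_leI bnd summableI) auto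
  also have "\<dots> = ennreal (\<Sum>i. g (Suc i))"
    by (rule suminf_ennreal2[OF g0 sg])
  finally show ?thesis by (simp add: le_less_trans)
qed

end

theory Submission
  imports Defs
begin

text \<open>
  Take \<open>Q\<^sub>i = 1\<close> and \<open>a\<^sub>i = i\<^sup>1\<^sup>/\<^sup>2\<close>, so that \<open>z\<^sub>s = 1\<close> and the equilibria are the geometric
  sequences \<open>z\<^sup>i\<close>. For fixed \<open>y < z\<close>, follow the equilibrium \<open>y\<^sup>i\<close> up to the size \<open>N\<close> and
  continue it geometrically with a larger ratio \<open>w < 1\<close> chosen to restore the mass \<open>\<rho>\<close>. The
  energy stays bounded below, because its first term depends on \<open>y\<close> and \<open>z\<close> only, whereas
  only sizes \<open>i \<ge> N\<close> dissipate. There \<open>a\<^sub>i \<le> i N\<^sup>-\<^sup>1\<^sup>/\<^sup>2\<close>, so the dissipation is bounded by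
  \<open>N\<^sup>-\<^sup>1\<^sup>/\<^sup>2\<close> times the mass and vanishes as \<open>N\<close> grows.
\<close>

section \<open>Critical density and equilibria for constant \<open>Q\<close>\<close>

lemma sums_nat_mult_power:
  fixes z :: real
  assumes "0 \<le> z" "z < 1"
  shows "(\<lambda>i. real i * z ^ i) sums (z / (1 - z)\<^sup>2)"
proof -
  have "(\<lambda>i. z * (real (Suc i) * z ^ i)) sums (z * (1 / (1 - z)\<^sup>2))"
    using assms by (intro sums_mult geometric_deriv_sums) simp
  then have "(\<lambda>i. real (Suc i) * z ^ Suc i) sums (z / (1 - z)\<^sup>2)"
    by (simp add: mult_ac)
  then show ?thesis by (subst (asm) sums_Suc_iff) simp
qed

text \<open>For \<open>z \<ge> 1\<close> all terms of positive index are at least 1. This caps the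
  critical density at 1 and confines candidate equilibrium densities to [0, 1).\<close>

lemma summable_nat_mult_power_imp_less_1:
  fixes z :: real
  assumes "0 \<le> z" "summable (\<lambda>i. real i * z ^ i)"
  shows "z < 1"
proof (rule ccontr)
  assume "\<not> z < 1"
  then have ge: "1 \<le> z" by simp
  have "(\<lambda>i. real i * z ^ i) \<longlonglongrightarrow> 0" by (rule summable_LIMSEQ_zero[OF assms(2)])
  then have "eventually (\<lambda>i. real i * z ^ i < 1) sequentially"
    by (rule order_tendstoD) simp
  then obtain N where "\<And>i. i \<ge> N \<Longrightarrow> real i * z ^ i < 1"
    by (auto simp: eventually_sequentially)
  from this[of "Suc N"] have "real (Suc N) * z ^ Suc N < 1" by simp
  moreover have "1 * 1 \<le> real (Suc N) * z ^ Suc N"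
    by (rule mult_mono) (use ge one_le_power[of z "Suc N"] in auto)
  ultimately show False by simp
qed

lemma critical_density_const: "critical_density (\<lambda>_. 1) = 1"
  unfolding critical_density_def
proof (rule Greatest_equality)
  show "\<forall>z\<ge>0. ennreal z < 1 \<longrightarrow> summable (\<lambda>i. real i * 1 * z ^ i)"
    using sums_summable[OF sums_nat_mult_power] by simp
next
  fix zs :: ennreal
  assume zs: "\<forall>z\<ge>0. ennreal z < zs \<longrightarrow> summable (\<lambda>i. real i * 1 * z ^ i)"
  show "zs \<le> 1"
  proof (rule ccontr)
    assume "\<not> zs \<le> 1"
    then have "summable (\<lambda>i. real i * 1 * 1 ^ i)" using zs[rule_format, of 1] by simp
    then show False using summable_nat_mult_power_imp_less_1[of 1] by simp
  qed
qed

text \<open>The numerator grows while the denominator shrinks. This yields uniqueness of the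
  equilibrium density and the mass deficit of \<open>y ^ i\<close> when
  \<open>y < z\<close>.\<close>

lemma geometric_mass_strict_mono:
  fixes y z :: real
  assumes "0 \<le> y" "y < z" "z < 1"
  shows "y / (1 - y)\<^sup>2 < z / (1 - z)\<^sup>2"
  using assms by (intro frac_less power_mono) auto

lemma equilibrium_density_const:
  assumes "0 < z" "z < 1"
  shows "equilibrium_density (\<lambda>_. 1) (z / (1 - z)\<^sup>2) = z"
  unfolding equilibrium_density_def
proof (rule the_equality)
  show "0 \<le> z \<and> (\<lambda>i. real i * 1 * z ^ i) sums (z / (1 - z)\<^sup>2)"
    using assms sums_nat_mult_power by simp
next
  fix x assume x: "0 \<le> x \<and> (\<lambda>i. real i * 1 * x ^ i) sums (z / (1 - z)\<^sup>2)"
  then have x1: "x < 1"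
    using summable_nat_mult_power_imp_less_1[of x] by (auto intro: sums_summable)
  have "x / (1 - x)\<^sup>2 = z / (1 - z)\<^sup>2"
    using sums_unique2[OF sums_nat_mult_power[of x]] x x1 by simp
  then show "x = z"
    using geometric_mass_strict_mono[of x z] geometric_mass_strict_mono[of z x] x x1 assms
    by (metis less_irrefl linorder_neqE_linordered_idom less_imp_le)
qed

lemma exists_equilibrium_density:
  fixes \<rho> :: real
  assumes "0 < \<rho>"
  obtains z where "0 < z" "z < 1" "\<rho> = z / (1 - z)\<^sup>2"
proof -
  \<comment> \<open>Clearing the denominator gives continuity up to \<open>z = 1\<close>; the end
    values \<open>h 0 = - \<rho>\<close> and \<open>h 1 = 1\<close> have opposite signs and are
    nonzero.\<close>
  define h where "h z = z - \<rho> * (1 - z)\<^sup>2" for z :: real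
  have "\<exists>z. 0 \<le> z \<and> z \<le> 1 \<and> h z = 0"
    by (rule IVT) (use assms in \<open>auto simp: h_def intro!: continuous_intros\<close>)
  then obtain z where z: "0 \<le> z" "z \<le> 1" "h z = 0" by blast
  have "z \<noteq> 0" "z \<noteq> 1" using z(3) assms by (auto simp: h_def)
  with z that[of z] show ?thesis by (auto simp: h_def field_simps)
qed

section \<open>Competitors of prescribed mass with a geometric tail\<close>

definition geometric_tail :: "real \<Rightarrow> real \<Rightarrow> nat \<Rightarrow> nat \<Rightarrow> real" where
  "geometric_tail y w N i = (if i \<le> N then y ^ i else y ^ N * w ^ (i - N))"

lemma geometric_tail_pos: "0 < y \<Longrightarrow> 0 < w \<Longrightarrow> 0 < geometric_tail y w N i"
  by (simp add: geometric_tail_def)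

text \<open>Both branches of the definition agree at \<open>i = N\<close>, so the ratio switches to
  \<open>w\<close> exactly in the step from \<open>N\<close> to \<open>Suc N\<close>.\<close>

lemma geometric_tail_Suc:
  "geometric_tail y w N (Suc i) = (if i < N then y else w) * geometric_tail y w N i"
proof (cases "N \<le> i")
  case True
  then show ?thesis by (auto simp: geometric_tail_def Suc_diff_le)
qed (simp add: geometric_tail_def)

lemma geometric_tail_mass:
  fixes y w :: real
  assumes "0 \<le> w" "w < 1"
  shows "(\<lambda>i. real i * geometric_tail y w N i) sums
           ((\<Sum>i<N. real i * y ^ i) + y ^ N * (real N / (1 - w) + w / (1 - w)\<^sup>2))"
proof -
  have "(\<lambda>k. y ^ N * (real N * w ^ k + real k * w ^ k)) sums
          (y ^ N * (real N * (1 / (1 - w)) + w / (1 - w)\<^sup>2))"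
    using assms by (intro sums_mult sums_add geometric_sums sums_nat_mult_power) auto
  also have "(\<lambda>k. y ^ N * (real N * w ^ k + real k * w ^ k)) =
      (\<lambda>k. real (k + N) * geometric_tail y w N (k + N))"
    by (auto simp: fun_eq_iff geometric_tail_def algebra_simps)
  \<comment> \<open>The finite sum stops below \<open>N\<close>: size \<open>N\<close> is the term
    \<open>k = 0\<close> of the tail.\<close>
  finally have "(\<lambda>i. real i * geometric_tail y w N i) sums
      (y ^ N * (real N * (1 / (1 - w)) + w / (1 - w)\<^sup>2)
        + (\<Sum>i<N. real i * geometric_tail y w N i))"
    by (subst (asm) sums_iff_shift) (simp add: add.commute)
  then show ?thesis by (simp add: geometric_tail_def add.commute)
qed

text \<open>The tail mass is too small at \<open>w = y\<close> and unbounded as \<open>w\<close>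
  tends to 1, so some ratio in between gives total mass \<rho>.\<close>

lemma exists_tail_ratio:
  fixes y \<rho> :: real
  assumes y: "0 < y" "y < 1" and less: "y / (1 - y)\<^sup>2 < \<rho>"
  obtains w where "y \<le> w" "w < 1" "(\<lambda>i. real i * geometric_tail y w N i) sums \<rho>"
proof -
  \<comment> \<open>\<open>T\<close> is the mass left for the sizes from \<open>N\<close> on,
    \<open>g w\<close> the mass they carry. \<open>h\<close> is their difference times
    \<open>(1 - w)\<^sup>2\<close>, written so that it is continuous at \<open>w = 1\<close>
    too.\<close>
  define T where "T = \<rho> - (\<Sum>i<N. real i * y ^ i)"
  define g where "g w = y ^ N * (real N / (1 - w) + w / (1 - w)\<^sup>2)" for w
  define h where "h w = y ^ N * (real N * (1 - w) + w) - (1 - w)\<^sup>2 * T" for w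
  have hg: "h w = (1 - w)\<^sup>2 * (g w - T)" if "w < 1" for w
  proof -
    have "(1 - w)\<^sup>2 * (real N / (1 - w) + w / (1 - w)\<^sup>2) = real N * (1 - w) + w"
      using that by (simp add: distrib_left power2_eq_square)
    then show ?thesis by (simp add: h_def g_def right_diff_distrib mult.left_commute)
  qed
  \<comment> \<open>At \<open>w = y\<close> the sequence is the equilibrium of density
    \<open>y\<close>, whose mass is below \<rho>.\<close>
  have "geometric_tail y y N = (\<lambda>i. y ^ i)"
    by (auto simp: geometric_tail_def fun_eq_iff simp flip: power_add)
  then have "(\<Sum>i<N. real i * y ^ i) + g y = y / (1 - y)\<^sup>2"
    using geometric_tail_mass[of y y N] sums_nat_mult_power[of y] y
    by (auto simp: g_def intro: sums_unique2)
  then have "g y < T" using less by (simp add: T_def)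
  then have hy: "h y \<le> 0" using y by (simp add: hg mult_le_0_iff)
  \<comment> \<open>Here \<open>h 1 = y ^ N\<close>; this also excludes \<open>w = 1\<close> as the
    root.\<close>
  have h1: "0 < h 1" using y by (simp add: h_def)
  have "\<exists>w. y \<le> w \<and> w \<le> 1 \<and> h w = 0"
    by (rule IVT) (use hy h1 y in \<open>auto simp: h_def intro!: continuous_intros\<close>)
  then obtain w where w: "y \<le> w" "w \<le> 1" "h w = 0" by blast
  with h1 have w1: "w < 1" by (cases "w = 1") auto
  then have "g w = T" using w hg[of w] by simp
  then have "(\<lambda>i. real i * geometric_tail y w N i) sums \<rho>"
    using geometric_tail_mass[of w y N] w1 w(1) y by (simp add: g_def T_def)
  then show ?thesis using that w(1) w1 by blast
qed

text \<open>Sizes below \<open>N\<close> are in detailed balance; each other summand is at most a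
  constant times the mass at its size. The constant is free of \<open>w\<close>, which varies with
  \<open>N\<close>.\<close>

lemma dissipation_geometric_tail_le:
  fixes y w :: real
  assumes y: "0 < y" and w: "y \<le> w" "w < 1" and N: "0 < N"
    and mass: "(\<lambda>i. real i * geometric_tail y w N i) sums \<rho>"
  shows "dissipation (\<lambda>i. sqrt (real i)) (\<lambda>_. 1) (geometric_tail y w N)
           \<le> ennreal (- ln y * \<rho> / sqrt (real N))"
proof -
  define c where "c = geometric_tail y w N"
  define K where "K = - ln y / sqrt (real N)"
  have pos: "0 < c i" for i using geometric_tail_pos[of y w N i] y w by (simp add: c_def)
  have c1: "c 1 = y" using N by (simp add: c_def geometric_tail_def)
  have lny: "0 \<le> - ln y" using y w by simp
  then have K: "0 \<le> K" unfolding K_def by (rule divide_nonneg_nonneg) simp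
  have le_summand: "ennreal (sqrt (real i) * 1) * log_gap (c 1 * c i / 1) (c (i + 1) / 1)
      \<le> ennreal (K * (real i * c i))" if i: "i \<ge> 1" for i
  proof (cases "i < N")
    case True
    \<comment> \<open>The ratio \<open>y\<close> equals \<open>c 1\<close>, so the two arguments of
      \<open>log_gap\<close> coincide.\<close>
    then have "c (i + 1) = c 1 * c i" unfolding c1 by (simp add: c_def geometric_tail_Suc)
    then show ?thesis using pos[of 1] pos[of i] by (simp add: log_gap_def)
  next
    case False
    then have step: "c (i + 1) = w * c i" by (simp add: c_def geometric_tail_Suc)
    have gap: "(y * c i - w * c i) * (ln (y * c i) - ln (w * c i))
        = c i * ((w - y) * (ln w - ln y))"
      using y w pos[of i] by (simp add: ln_mult algebra_simps)
    \<comment> \<open>Uniform in \<open>w\<close>: \<open>w - y \<le> 1\<close> and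
      \<open>ln w \<le> 0\<close>.\<close>
    have "(w - y) * (ln w - ln y) \<le> 1 * (- ln y)"
      using y w by (intro mult_mono) auto
    \<comment> \<open>Sublinear growth of the coagulation coefficients enters here:
      \<open>i \<ge> N\<close> gains the factor \<open>1 / sqrt N\<close> over linear
      growth.\<close>
    moreover have "sqrt (real i) \<le> real i / sqrt (real N)"
    proof -
      have "sqrt (real i) * sqrt (real N) \<le> sqrt (real i) * sqrt (real i)"
        using False by (intro mult_left_mono) auto
      then show ?thesis using N by (simp add: field_simps)
    qed
    ultimately have "sqrt (real i) * (c i * ((w - y) * (ln w - ln y)))
        \<le> real i / sqrt (real N) * (c i * (- ln y))"
      using y w pos[of i] lny by (intro mult_mono mult_left_mono) auto
    also have "\<dots> = K * (real i * c i)" by (simp add: K_def)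
    finally have le: "sqrt (real i) * (c i * ((w - y) * (ln w - ln y))) \<le> K * (real i * c i)" .
    have "y * c i \<noteq> 0" "w * c i \<noteq> 0" using y w pos[of i] by auto
    then have "log_gap (y * c i) (w * c i) = ennreal (c i * ((w - y) * (ln w - ln y)))"
      by (simp only: log_gap_def gap if_False simp_thms)
    then show ?thesis
      using le by (simp add: c1[unfolded One_nat_def] step[unfolded Suc_eq_plus1[symmetric]]
          ennreal_mult'[symmetric] ennreal_leI)
  qed
  have "dissipation (\<lambda>i. sqrt (real i)) (\<lambda>_. 1) c
      \<le> (\<Sum>j. ennreal (K * (real (Suc j) * c (Suc j))))"
    unfolding dissipation_def Let_def by (intro suminf_le le_summand summableI) auto
  also have "(\<lambda>i. K * (real i * c i)) sums (K * \<rho>)"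
    using mass unfolding c_def by (rule sums_mult)
  then have "(\<lambda>j. K * (real (Suc j) * c (Suc j))) sums (K * \<rho>)"
    by (subst sums_Suc_iff) simp
  then have "(\<Sum>j. ennreal (K * (real (Suc j) * c (Suc j)))) = ennreal (K * \<rho>)"
    by (intro suminf_ennreal_eq mult_nonneg_nonneg K less_imp_le[OF pos] of_nat_0_le_iff)
  finally show ?thesis by (simp add: c_def K_def)
qed

text \<open>The logarithm lies strictly below its tangent at 1, here evaluated at
  \<open>1 / r\<close>.\<close>

lemma entropy_fun_pos:
  assumes "0 < r" "r \<noteq> 1"
  shows "0 < entropy_fun r"
proof -
  have "ln (1 / r) < 1 / r - 1"
    using assms ln_eq_minus_one[of "1 / r"] ln_le_minus_one[of "1 / r"] by force
  then have "r * ln (1 / r) < r * (1 / r - 1)"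
    using assms by (intro mult_strict_left_mono) auto
  then show ?thesis using assms by (simp add: entropy_fun_def ln_div right_diff_distrib)
qed

lemma ennreal_inverse_antimono: "x \<le> y \<Longrightarrow> inverse y \<le> inverse (x :: ennreal)"
  including ennreal.lifting by transfer (rule ereal_inverse_antimono)

text \<open>The monomer term suffices, since the competitors keep the same monomer density
  \<open>y\<close> for every \<open>N > 0\<close>.\<close>

lemma relative_energy_ge_first:
  "ennreal (E 1 * entropy_fun (c 1 / E 1)) \<le> relative_energy c E"
  using sum_le_suminf[OF summableI, of "{0}"
      "\<lambda>i. ennreal (E (Suc i) * entropy_fun (c (Suc i) / E (Suc i)))"]
  by (simp add: relative_energy_def)

lemma INF_dissipation_quotient_eq_0:
  fixes \<rho> :: real
  assumes "0 < \<rho>"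
  shows "(INF c \<in> {c \<in> mass_space \<rho>. \<exists>i\<ge>1. c i \<noteq> equilibrium (\<lambda>_. 1) \<rho> i}.
           dissipation (\<lambda>i. sqrt (real i)) (\<lambda>_. 1) c
             / relative_energy c (equilibrium (\<lambda>_. 1) \<rho>)) = 0"
    (is "?I = 0")
proof -
  obtain z where z: "0 < z" "z < 1" "\<rho> = z / (1 - z)\<^sup>2"
    using exists_equilibrium_density[OF assms] by blast
  have eq1: "equilibrium (\<lambda>_. 1) \<rho> 1 = z"
    by (simp add: equilibrium_def z equilibrium_density_const)
  \<comment> \<open>Any value strictly between 0 and \<open>z\<close> would serve, chosen before
    \<open>n\<close> so that \<open>h\<close> bounds all the energies from below.\<close>
  define y where "y = z / 2"
  have y: "0 < y" "y < z" "y < 1" using z by (auto simp: y_def)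
  define h where "h = z * entropy_fun (y / z)"
  have h: "0 < h" using y z by (simp add: h_def entropy_fun_pos)
  have bound: "?I \<le> ennreal (- ln y * \<rho> / h * inverse (sqrt (real (Suc n))))" for n
  proof -
    obtain w where w: "y \<le> w" "w < 1" "(\<lambda>i. real i * geometric_tail y w (Suc n) i) sums \<rho>"
      using exists_tail_ratio[of y \<rho>] y z geometric_mass_strict_mono[of y z] by auto
    define c where "c = geometric_tail y w (Suc n)"
    have c1: "c 1 = y" by (simp add: c_def geometric_tail_def)
    have "0 \<le> c i" for i
      using geometric_tail_pos[of y w "Suc n" i] y w by (simp add: c_def)
    then have "c \<in> mass_space \<rho>" using w(3) by (simp add: mass_space_def c_def)
    moreover have "\<exists>i\<ge>1. c i \<noteq> equilibrium (\<lambda>_. 1) \<rho> i"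
      using c1 eq1 y by (intro exI[of _ 1]) auto
    ultimately have "?I \<le> dissipation (\<lambda>i. sqrt (real i)) (\<lambda>_. 1) c
        / relative_energy c (equilibrium (\<lambda>_. 1) \<rho>)"
      by (intro INF_lower) simp
    also have "\<dots> \<le> ennreal (- ln y * \<rho> / sqrt (real (Suc n))) / ennreal h"
      unfolding divide_ennreal_def
    proof (intro mult_mono ennreal_inverse_antimono)
      show "dissipation (\<lambda>i. sqrt (real i)) (\<lambda>_. 1) c
          \<le> ennreal (- ln y * \<rho> / sqrt (real (Suc n)))"
        unfolding c_def by (rule dissipation_geometric_tail_le) (use y w in auto)
      show "ennreal h \<le> relative_energy c (equilibrium (\<lambda>_. 1) \<rho>)"
        using relative_energy_ge_first[of "equilibrium (\<lambda>_. 1) \<rho>" c] unfolding c1 eq1 h_def .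
    qed simp_all
    also have "\<dots> = ennreal (- ln y * \<rho> / sqrt (real (Suc n)) / h)"
      by (rule divide_ennreal, intro divide_nonneg_nonneg mult_nonneg_nonneg)
        (use h y assms in simp_all)
    finally show ?thesis by (simp add: field_simps)
  qed
  have "(\<lambda>n. - ln y * \<rho> / h * inverse (sqrt (real (Suc n)))) \<longlonglongrightarrow> - ln y * \<rho> / h * 0"
    by (intro tendsto_mult tendsto_const tendsto_inverse_0_at_top
        filterlim_compose[OF sqrt_at_top] filterlim_compose[OF filterlim_real_sequentially]
        filterlim_Suc)
  then have "(\<lambda>n. ennreal (- ln y * \<rho> / h * inverse (sqrt (real (Suc n))))) \<longlonglongrightarrow> ennreal 0"
    by (intro tendsto_ennrealI) simp
  then have "?I \<le> ennreal 0"
    by (rule LIMSEQ_le_const) (use bound in blast)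
  then show ?thesis by simp
qed

theorem theorem1p2:
  "\<exists>(a :: nat \<Rightarrow> real) (b :: nat \<Rightarrow> real) (Q :: nat \<Rightarrow> real).
     (\<forall>i\<ge>1. 0 < a i) \<and> (\<forall>i\<ge>2. 0 < b i) \<and> detailed_balance a b Q \<and>
     (0 < critical_density Q \<and> critical_density Q < \<infinity>) \<and>
     (\<exists>\<alpha> :: nat \<Rightarrow> real.
        (\<forall>i\<ge>1. Q i = enn2real (critical_density Q) powi (1 - int i) * \<alpha> i) \<and>
        (\<forall>i\<ge>1. 0 < \<alpha> i) \<and>
        (\<forall>i\<ge>1. \<alpha> (i + 1) \<le> \<alpha> i) \<and>
        (\<lambda>i. \<alpha> (i + 1) / \<alpha> i) \<longlonglongrightarrow> 1) \<and>
     (\<exists>\<gamma> :: real. 0 < \<gamma> \<and> \<gamma> < 1 \<and>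
        (\<exists>C1>0. \<exists>C2>0. \<forall>i\<ge>1.
           C1 * real i powr \<gamma> \<le> a i \<and> a i \<le> C2 * real i powr \<gamma>)) \<and>
     (\<forall>\<rho> :: real. 0 < \<rho> \<and> ennreal \<rho> < critical_mass Q \<longrightarrow>
        (INF c \<in> {c \<in> mass_space \<rho>. \<exists>i\<ge>1. c i \<noteq> equilibrium Q \<rho> i}.
           dissipation a Q c / relative_energy c (equilibrium Q \<rho>)) = 0)"
\<comment> \<open>Constant \<open>Q\<close> forces \<open>b (i + 1) = a i\<close>, whence the shift
  in \<open>b\<close>; \<alpha> is constant 1 as well.\<close>
proof (rule exI[of _ "\<lambda>i. sqrt (real i)"], rule exI[of _ "\<lambda>i. sqrt (real (i - 1))"],
    rule exI[of _ "\<lambda>_. 1"], intro conjI)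
  show "\<exists>\<gamma> :: real. 0 < \<gamma> \<and> \<gamma> < 1 \<and>
      (\<exists>C1>0. \<exists>C2>0. \<forall>i\<ge>1. C1 * real i powr \<gamma> \<le> sqrt (real i) \<and> sqrt (real i) \<le> C2 * real i powr \<gamma>)"
    by (rule exI[of _ "1/2"]) (auto simp: powr_half_sqrt intro!: exI[of _ "1::real"])
qed (auto simp: detailed_balance_def critical_density_const
    INF_dissipation_quotient_eq_0[unfolded One_nat_def] intro!: exI[of _ "\<lambda>_. 1"])

end
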